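(* For $\xi\in[0,1)$ consider the generalized Pareto distribution with tail index $\xi$ and scale parameter $\sigma>0$, with density $f_\xi(y)=\sigma^{-1}(1+\xi y/\sigma)^{-1/\xi-1}$, $y>0$, and let the base model, induced by $\xi_b=0$, be the exponential distribution with density $\sigma^{-1}\exp(-y/\sigma)$, $y>0$. Then the $\mathrm{WCP}_1$ prior for $\xi$ with respect to this base model is $$\pi(\xi)=\frac{\eta}{(1-\xi)^2}\exp\left(-\eta\,\frac{\xi}{1-\xi}\right),\qquad \xi\in(0,1),$$ where $\eta>0$ is the user-specified hyperparameter controlling the tail mass.
   Context: Wasserstein-$p$ distance on $\mathbb R$, $p\ge1$: $W_p(\mu,\nu)=\bigl(\inf_{\pi\in\Pi(\mu,\nu)}\int|x-y|^p\,d\pi(x,y)\bigr)^{1/p}$, where $\Pi(\mu,\nu)$ is the set of probability measures on $\mathbb R\times\mathbb R$ with marginals $\mu$ and $\nu$. One-sided univariate $\mathrm{WCP}_p$ prior. Let $\{\mu_\theta:\theta\in(\theta_-,\theta_+)\}$ be a model class of probability measures with finite $p$th moments and with base measure $\mu_b$ corresponding to the boundary value $\theta_b=\theta_-$ of the parameter interval. Put $W_p(\theta)=W_p(\mu_\theta,\mu_b)$ and $c=\sup_\theta W_p(\theta)\in(0,\infty]$, assuming that $W_p(\cdot)$ is injective and differentiable, tends to $0$ as $\theta\to\theta_b$ and tends to $c$ as $\theta\to\theta_+$. For a user-specified hyperparameter $\eta>0$, the $\mathrm{WCP}_p$ prior density of $\theta$ is $$\pi(\theta)=\frac{\eta\,e^{-\eta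 W_p(\theta)}}{1-e^{-\eta c}}\left|\frac{dW_p(\theta)}{d\theta}\right|,\qquad e^{-\infty}:=0.$$ Here $p=1$, $\theta=\xi$, the parameter interval is $(0,1)$, and $\theta_b=\xi_b=0$; at $\xi=0$ the generalized Pareto distribution is understood as the exponential distribution above.
   Formalization: The stated density is proved for the WCP_1 prior with hyperparameter η/σ in place of η; since W_1(ξ) = σξ/(1−ξ), the claim with hyperparameter η itself holds only for σ = 1. *)

theory Defs
  imports "HOL-Probability.Probability"
begin

definition couplings :: "real measure \<Rightarrow> real measure \<Rightarrow> (real \<times> real) measure set" where
  "couplings \<mu> \<nu> = {\<pi>. prob_space \<pi> \<and> sets \<pi> = sets (borel \<Otimes>\<^sub>M borel) \<and>
     distr \<pi> borel fst = \<mu> \<and> distr \<pi> borel snd = \<nu>}"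

(* The infimum is taken in ennreal.  It is finite for probability measures with finite p-th
   moments; only outside that case does enn2real replace an infinite cost by 0. *)
definition wasserstein :: "real \<Rightarrow> real measure \<Rightarrow> real measure \<Rightarrow> real" where
  "wasserstein p \<mu> \<nu> =
     enn2real (INF \<pi>\<in>couplings \<mu> \<nu>. \<integral>\<^sup>+(x, y). ennreal (\<bar>x - y\<bar> powr p) \<partial>\<pi>) powr (1 / p)"

definition finite_moment_prob :: "real \<Rightarrow> real measure \<Rightarrow> bool" where
  "finite_moment_prob p \<mu> \<longleftrightarrow> prob_space \<mu> \<and> sets \<mu> = sets borel \<and>
     integrable \<mu> (\<lambda>x. \<bar>x\<bar> powr p)"

definition wcp_sup :: "real \<Rightarrow> (real \<Rightarrow> real measure) \<Rightarrow> real measure \<Rightarrow> ereal \<Rightarrow> ereal \<Rightarrow> ereal" where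
  "wcp_sup p \<mu> \<mu>b l u = (SUP \<theta>\<in>einterval l u. ereal (wasserstein p (\<mu> \<theta>) \<mu>b))"

(* Standing assumptions for the one-sided prior on the interval (l, u), whose left end point l
   is the parameter value of the base measure.  The end points may be infinite. *)
definition wcp_setting :: "real \<Rightarrow> (real \<Rightarrow> real measure) \<Rightarrow> real measure \<Rightarrow> ereal \<Rightarrow> ereal \<Rightarrow> bool" where
  "wcp_setting p \<mu> \<mu>b l u \<longleftrightarrow>
     1 \<le> p \<and> l < u \<and>
     finite_moment_prob p \<mu>b \<and>
     (\<forall>\<theta>\<in>einterval l u. finite_moment_prob p (\<mu> \<theta>)) \<and>
     0 < wcp_sup p \<mu> \<mu>b l u \<and>
     inj_on (\<lambda>\<theta>. wasserstein p (\<mu> \<theta>) \<mu>b) (einterval l u) \<and>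
     (\<lambda>\<theta>. wasserstein p (\<mu> \<theta>) \<mu>b) differentiable_on (einterval l u) \<and>
     (((\<lambda>\<theta>. wasserstein p (\<mu> \<theta>) \<mu>b) \<circ> real_of_ereal) \<longlongrightarrow> 0) (at_right l) \<and>
     (((\<lambda>\<theta>. ereal (wasserstein p (\<mu> \<theta>) \<mu>b)) \<circ> real_of_ereal)
        \<longlongrightarrow> wcp_sup p \<mu> \<mu>b l u) (at_left u)"

definition exp_neg_ereal :: "ereal \<Rightarrow> real" where
  "exp_neg_ereal x = (if x = \<infinity> then 0 else exp (- real_of_ereal x))"

definition wcp_prior ::
  "real \<Rightarrow> (real \<Rightarrow> real measure) \<Rightarrow> real measure \<Rightarrow> ereal \<Rightarrow> ereal \<Rightarrow> real \<Rightarrow> real \<Rightarrow> real" where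
  "wcp_prior p \<mu> \<mu>b l u \<eta> \<theta> =
     \<eta> * exp (- \<eta> * wasserstein p (\<mu> \<theta>) \<mu>b) / (1 - exp_neg_ereal (ereal \<eta> * wcp_sup p \<mu> \<mu>b l u))
       * \<bar>deriv (\<lambda>t. wasserstein p (\<mu> t) \<mu>b) \<theta>\<bar>"

definition gpd_density :: "real \<Rightarrow> real \<Rightarrow> real \<Rightarrow> real" where
  "gpd_density \<sigma> \<xi> y =
     (if \<xi> = 0 then exponential_density (1 / \<sigma>) y
      else if 0 < y then (1 / \<sigma>) * (1 + \<xi> * y / \<sigma>) powr (- 1 / \<xi> - 1)
      else 0)"

definition gpd :: "real \<Rightarrow> real \<Rightarrow> real measure" where
  "gpd \<sigma> \<xi> = density lborel (\<lambda>y. ennreal (gpd_density \<sigma> \<xi> y))"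

end

(* The increasing map T y = \<sigma> / \<xi> * (exp (\<xi> * y / \<sigma>) - 1) transports the exponential
   distribution to the generalized Pareto distribution, and T y \<ge> y.  The coupling induced by T
   therefore costs the difference of the two means, which is also a lower bound for the cost of
   every coupling.  Hence W_1 = \<sigma> / (1 - \<xi>) - \<sigma> = \<sigma> * \<xi> / (1 - \<xi>), which is unbounded, so the
   normalising factor of the prior is 1. *)
theory Submission
  imports Defs "HOL-Real_Asymp.Real_Asymp"
begin

section \<open>Optimal cost of moving mass to the right\<close>

lemma wasserstein1_distr_eq_mean_diff:
  fixes T :: "real \<Rightarrow> real"
  assumes "prob_space \<nu>" and sets: "sets \<nu> = sets borel"
    and T: "T \<in> borel_measurable borel"
    and ge: "AE y in \<nu>. y \<le> T y"
    and int: "integrable \<nu> (\<lambda>y. y)" "integrable \<nu> T"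
  shows "wasserstein 1 (distr \<nu> borel T) \<nu> = (\<integral>y. T y \<partial>\<nu>) - (\<integral>y. y \<partial>\<nu>)"
proof -
  interpret prob_space \<nu> by fact
  note [measurable] = T
  note [measurable_cong] = sets
  let ?D = "(\<integral>y. T y \<partial>\<nu>) - (\<integral>y. y \<partial>\<nu>)"
  let ?cost = "\<lambda>\<pi>. \<integral>\<^sup>+(x, y). ennreal (\<bar>x - y\<bar> powr 1) \<partial>\<pi>"
  \<comment> \<open>The image point comes first because \<open>\<nu>\<close> has to be the second
    marginal.\<close>
  let ?\<pi> = "distr \<nu> (borel \<Otimes>\<^sub>M borel) (\<lambda>y. (T y, y))"
  have T': "T \<in> measurable \<nu> borel" by measurable
  have D: "?D = (\<integral>y. T y - y \<partial>\<nu>)"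
    using int by simp
  have "prob_space ?\<pi>" by (rule prob_space_distr) measurable
  moreover have "distr ?\<pi> borel snd = \<nu>"
  proof -
    have "distr ?\<pi> borel snd = distr \<nu> borel (\<lambda>y. y)"
      by (subst distr_distr) (auto simp: comp_def)
    also have "\<dots> = \<nu>" using sets by (simp add: distr_id2)
    finally show ?thesis .
  qed
  moreover have "distr ?\<pi> borel fst = distr \<nu> borel T"
    by (subst distr_distr) (auto simp: comp_def)
  ultimately have mem: "?\<pi> \<in> couplings (distr \<nu> borel T) \<nu>"
    by (simp add: couplings_def)
  have "?cost ?\<pi> = (\<integral>\<^sup>+y. ennreal (\<bar>T y - y\<bar> powr 1) \<partial>\<nu>)"
    by (subst nn_integral_distr) auto
  also have "\<dots> = (\<integral>\<^sup>+y. ennreal (T y - y) \<partial>\<nu>)"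
    using ge by (intro nn_integral_cong_AE) (auto elim!: eventually_mono)
  also have "\<dots> = ennreal ?D"
    unfolding D
  proof (rule nn_integral_eq_integral)
    show "integrable \<nu> (\<lambda>y. T y - y)" using int by simp
    show "AE y in \<nu>. 0 \<le> T y - y" using ge by simp
  qed
  finally have upper: "?cost ?\<pi> = ennreal ?D" .
  have lower: "ennreal ?D \<le> ?cost \<pi>" if "\<pi> \<in> couplings (distr \<nu> borel T) \<nu>" for \<pi>
  proof -
    from that have s[measurable_cong]: "sets \<pi> = sets (borel \<Otimes>\<^sub>M borel)"
      and m: "distr \<pi> borel fst = distr \<nu> borel T" "distr \<pi> borel snd = \<nu>"
      by (simp_all only: couplings_def mem_Collect_eq)
    have "integrable (distr \<nu> borel T) (\<lambda>x. x)"
      using int(2) by (simp add: integrable_distr_eq[OF T'])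
    then have i1: "integrable \<pi> fst"
      unfolding m(1)[symmetric] by (subst (asm) integrable_distr_eq) auto
    have i2: "integrable \<pi> snd"
    proof -
      have "integrable (distr \<pi> borel snd) (\<lambda>x. x)" using int(1) by (simp only: m)
      then show ?thesis by (subst (asm) integrable_distr_eq) auto
    qed
    have "(\<integral>y. T y \<partial>\<nu>) = (\<integral>x. x \<partial>distr \<pi> borel fst)"
      unfolding m by (simp add: integral_distr[OF T'])
    also have "\<dots> = (\<integral>z. fst z \<partial>\<pi>)"
      by (subst integral_distr) auto
    finally have e1: "(\<integral>y. T y \<partial>\<nu>) = (\<integral>z. fst z \<partial>\<pi>)" .
    have "(\<integral>y. y \<partial>\<nu>) = (\<integral>x. x \<partial>distr \<pi> borel snd)"
      unfolding m by simp
    also have "\<dots> = (\<integral>z. snd z \<partial>\<pi>)"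
      by (subst integral_distr) auto
    finally have "?D = (\<integral>z. fst z - snd z \<partial>\<pi>)" using e1 i1 i2 by simp
    also have "\<dots> \<le> (\<integral>z. \<bar>fst z - snd z\<bar> \<partial>\<pi>)"
      using i1 i2 by (intro integral_mono) auto
    finally have "ennreal ?D \<le> ennreal (\<integral>z. \<bar>fst z - snd z\<bar> \<partial>\<pi>)"
      by (rule ennreal_leI)
    also have "\<dots> = (\<integral>\<^sup>+z. ennreal \<bar>fst z - snd z\<bar> \<partial>\<pi>)"
      using i1 i2 by (intro nn_integral_eq_integral[symmetric]) simp_all
    also have "\<dots> = ?cost \<pi>"
      by (intro nn_integral_cong) (auto simp: case_prod_beta)
    finally show ?thesis .
  qed
  have "(INF \<pi>\<in>couplings (distr \<nu> borel T) \<nu>. ?cost \<pi>) = ennreal ?D"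
    using INF_lower[OF mem, of ?cost] unfolding upper by (intro antisym INF_greatest lower)
  \<comment> \<open>\<open>ennreal\<close> truncates negative reals to 0, so \<open>enn2real\<close>
    returns \<open>?D\<close> only once its sign is known; the exponent 1 / 1 then also leaves it
    unchanged.\<close>
  moreover have "0 \<le> ?D"
    unfolding D using ge by (intro integral_nonneg_AE) auto
  ultimately show ?thesis by (simp add: wasserstein_def)
qed

section \<open>The exponential distribution\<close>

text \<open>Exponential tilting: multiplying the density of rate \<open>l\<close> by
  \<open>exp (s * y)\<close> gives l / (l - s) times the density of rate \<open>l - s\<close>, which
  has total mass 1. The condition \<open>s < l\<close> keeps the new rate positive.\<close>

lemma has_bochner_integral_exp_exponential:
  fixes l s :: real
  assumes "0 < l" "s < l"
  shows "has_bochner_integral (density lborel (exponential_density l)) (\<lambda>y. exp (s * y)) (l / (l - s))"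
proof -
  have nn: "AE x in lborel. 0 \<le> exponential_density l x" if "0 < l" for l
    using that by (simp add: exponential_density_nonneg)
  interpret prob_space "density lborel (exponential_density (l - s))"
    using assms by (intro prob_space_exponential_density) simp
  \<comment> \<open>Integrating the constant 1 against the tilted law turns its total mass into a
    Lebesgue integral of its density.\<close>
  have "has_bochner_integral (density lborel (exponential_density (l - s))) (\<lambda>_. 1 :: real) 1"
    using prob_space by (simp add: has_bochner_integral_iff)
  then have "integrable lborel (exponential_density (l - s))"
    and "integral\<^sup>L lborel (exponential_density (l - s)) = 1"
    using integrable_density[of "\<lambda>_. 1 :: real" lborel "exponential_density (l - s)"]
      integral_density[of "\<lambda>_. 1 :: real" lborel "exponential_density (l - s)"] nn[of "l - s"] assms
    by (simp_all add: has_bochner_integral_iff)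
  then have "has_bochner_integral lborel (\<lambda>x. l / (l - s) * exponential_density (l - s) x) (l / (l - s))"
    by (simp add: has_bochner_integral_iff)
  moreover have "(\<lambda>x. exponential_density l x *\<^sub>R exp (s * x))
      = (\<lambda>x. l / (l - s) * exponential_density (l - s) x)"
  proof
    fix x
    have "exp (- x * l) * exp (s * x) = exp (- x * (l - s))"
      by (simp add: exp_add[symmetric] algebra_simps)
    then show "exponential_density l x *\<^sub>R exp (s * x) = l / (l - s) * exponential_density (l - s) x"
      using assms by (simp add: exponential_density_def)
  qed
  ultimately show ?thesis
    using nn[of l] assms by (intro has_bochner_integral_density) auto
qed

context
  fixes \<sigma> :: real
  assumes \<sigma>: "\<sigma> > 0"
begin

lemma gpd_0: "gpd \<sigma> 0 = density lborel (exponential_density (1 / \<sigma>))"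
  by (simp add: gpd_def gpd_density_def)

lemma prob_space_gpd_0: "prob_space (gpd \<sigma> 0)"
  unfolding gpd_0 using \<sigma> by (intro prob_space_exponential_density) simp

lemma sets_gpd: "sets (gpd \<sigma> \<xi>) = sets borel"
  by (simp add: gpd_def)

text \<open>Views the identity as an exponentially distributed random variable, so that the known
  facts on tails and moments of such variables apply to the measure itself.\<close>

lemma distributed_gpd_0:
  "distributed (gpd \<sigma> 0) lborel (\<lambda>y. y) (exponential_density (1 / \<sigma>))"
  unfolding distributed_def using \<sigma>
  by (auto simp: gpd_0 exponential_density_nonneg distr_id2)

lemma AE_gpd_0_pos: "AE y in gpd \<sigma> 0. 0 < y"
proof -
  \<comment> \<open>\<open>exponential_density\<close> is positive at 0, so this point must be
    discarded as a Lebesgue null set.\<close>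
  have "AE y in lborel. y \<noteq> (0::real)" by (rule AE_lborel_singleton)
  then show ?thesis
    unfolding gpd_0 by (subst AE_density) (auto simp: exponential_density_def elim!: eventually_mono)
qed

lemma mean_gpd_0: "has_bochner_integral (gpd \<sigma> 0) (\<lambda>y. y) \<sigma>"
proof -
  interpret prob_space "gpd \<sigma> 0" by (rule prob_space_gpd_0)
  \<comment> \<open>The exponential law is the Erlang law with index 0; the Erlang moment fact
    supplies integrability, which the value of the expectation alone does not give.\<close>
  show ?thesis
    using exponential_distributed_expectation[OF _ distributed_gpd_0]
      erlang_ith_moment_integrable[OF _ distributed_gpd_0, of 1] \<sigma>
    by (simp add: has_bochner_integral_iff)
qed

lemma emeasure_gpd_0_greaterThan:
  assumes "0 \<le> b"
  shows "emeasure (gpd \<sigma> 0) {b<..} = ennreal (exp (- b / \<sigma>))"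
proof -
  interpret prob_space "gpd \<sigma> 0" by (rule prob_space_gpd_0)
  have "{y \<in> space (gpd \<sigma> 0). b < y} = {b<..}" by (auto simp: gpd_def)
  then show ?thesis
    using exponential_distributedD_gt[OF distributed_gpd_0 assms] \<sigma>
    by (simp add: emeasure_eq_measure)
qed

section \<open>Transport from the exponential to the generalized Pareto law\<close>

text \<open>For \<xi> > 0 and y > 0 this is the generalized Pareto quantile function, u mapped to
  \<sigma> / \<xi> * ((1 - u) powr (- \<xi>) - 1), evaluated at the exponential distribution
  function u = 1 - exp (- y / \<sigma>).\<close>

definition gpd_map :: "real \<Rightarrow> real \<Rightarrow> real" where
  "gpd_map \<xi> y = \<sigma> / \<xi> * (exp (\<xi> * y / \<sigma>) - 1)"

lemma gpd_map_measurable [measurable]: "gpd_map \<xi> \<in> borel_measurable borel"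
  unfolding gpd_map_def by measurable

text \<open>The bound exp t \<ge> 1 + t at t = \<xi> * y / \<sigma>. It says that mass only moves to
  the right.\<close>

lemma gpd_map_ge:
  assumes "0 < \<xi>"
  shows "y \<le> gpd_map \<xi> y"
proof -
  have "y = \<sigma> / \<xi> * (\<xi> * y / \<sigma>)" using assms \<sigma> by simp
  also have "\<dots> \<le> gpd_map \<xi> y"
  proof -
    have "\<xi> * y / \<sigma> \<le> exp (\<xi> * y / \<sigma>) - 1"
      using exp_ge_add_one_self[of "\<xi> * y / \<sigma>"] by linarith
    then show ?thesis
      unfolding gpd_map_def using assms \<sigma> by (intro mult_left_mono) auto
  qed
  finally show ?thesis .
qed

text \<open>Inverts the map, so that tails of the image law become exponential tails. The condition
  \<open>0 \<le> b\<close> keeps the argument of \<open>ln\<close> positive.\<close>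

lemma less_gpd_map_iff:
  assumes "0 < \<xi>" "0 \<le> b"
  shows "b < gpd_map \<xi> y \<longleftrightarrow> \<sigma> / \<xi> * ln (1 + \<xi> * b / \<sigma>) < y"
proof -
  have p: "0 < 1 + \<xi> * b / \<sigma>" using assms \<sigma> by (simp add: add_pos_nonneg)
  have "b < gpd_map \<xi> y \<longleftrightarrow> 1 + \<xi> * b / \<sigma> < exp (\<xi> * y / \<sigma>)"
    unfolding gpd_map_def using assms \<sigma> by (auto simp: field_simps)
  also have "\<dots> \<longleftrightarrow> ln (1 + \<xi> * b / \<sigma>) < \<xi> * y / \<sigma>"
    using p by (metis exp_less_cancel_iff exp_ln)
  also have "\<dots> \<longleftrightarrow> \<sigma> / \<xi> * ln (1 + \<xi> * b / \<sigma>) < y"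
    using assms \<sigma> by (simp add: field_simps)
  finally show ?thesis .
qed

text \<open>The density has the antiderivative \<open>?F\<close>, which vanishes at infinity. Since
  the density is 0 on the nonpositive axis, a negative \<open>a\<close> acts like 0.\<close>

lemma emeasure_gpd_greaterThan:
  assumes "0 < \<xi>"
  shows "emeasure (gpd \<sigma> \<xi>) {a<..} = ennreal ((1 + \<xi> * max a 0 / \<sigma>) powr (- 1 / \<xi>))"
proof -
  let ?b = "max a 0"
  let ?f = "\<lambda>y. 1 / \<sigma> * (1 + \<xi> * y / \<sigma>) powr (- 1 / \<xi> - 1)"
  let ?F = "\<lambda>y. - ((1 + \<xi> * y / \<sigma>) powr (- 1 / \<xi>))"
  have "emeasure (gpd \<sigma> \<xi>) {a<..} = (\<integral>\<^sup>+y. ennreal (gpd_density \<sigma> \<xi> y) * indicator {a<..} y \<partial>lborel)"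
    unfolding gpd_def using assms
    by (subst emeasure_density) (auto simp: gpd_density_def[abs_def])
  \<comment> \<open>Closing the half-line at \<open>?b\<close> changes the integrand on a null set
    only.\<close>
  also have "\<dots> = (\<integral>\<^sup>+y. ennreal (?f y) * indicator {?b..} y \<partial>lborel)"
    using AE_lborel_singleton[of ?b] assms
    by (intro nn_integral_cong_AE) (auto simp: gpd_density_def split: split_indicator elim!: eventually_mono)
  also have "\<dots> = 0 - ?F ?b"
  proof (rule nn_integral_FTC_atLeast)
    fix x assume "?b \<le> x"
    then have p: "0 < 1 + \<xi> * x / \<sigma>" using assms \<sigma> by (simp add: add_pos_nonneg)
    have "(?F has_real_derivative
        - ((- 1 / \<xi>) * (1 + \<xi> * x / \<sigma>) powr (- 1 / \<xi> - 1) * (\<xi> / \<sigma>))) (at x)"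
      using p \<sigma> by (auto intro!: derivative_eq_intros)
    then show "(?F has_real_derivative ?f x) (at x)"
      using assms by simp
    show "0 \<le> ?f x" using \<sigma> by simp
  next
    have "((\<lambda>y. (1 + \<xi> * y / \<sigma>) powr (- 1 / \<xi>)) \<longlongrightarrow> 0) at_top"
    proof (rule tendsto_neg_powr)
      show "filterlim (\<lambda>y. 1 + \<xi> * y / \<sigma>) at_top at_top"
        using assms \<sigma> by real_asymp
    qed (use assms in auto)
    then show "(?F \<longlongrightarrow> 0) at_top" using tendsto_minus by fastforce
  qed measurable
  finally show ?thesis by simp
qed

text \<open>Borel measures on the line with finite and equal values on all open right rays coincide,
  so comparing tails is enough.\<close>

lemma gpd_eq_distr:
  assumes "0 < \<xi>"
  shows "gpd \<sigma> \<xi> = distr (gpd \<sigma> 0) borel (gpd_map \<xi>)"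
proof (rule measure_eqI_lessThan)
  fix a :: real
  note [measurable_cong] = sets_gpd
  let ?b = "max a 0"
  let ?c = "\<sigma> / \<xi> * ln (1 + \<xi> * ?b / \<sigma>)"
  show "emeasure (gpd \<sigma> \<xi>) {a<..} < \<infinity>"
    by (simp add: emeasure_gpd_greaterThan assms)
  have p: "1 \<le> 1 + \<xi> * ?b / \<sigma>" using assms \<sigma> by simp
  then have c: "0 \<le> ?c" using assms \<sigma> by simp
  have "emeasure (distr (gpd \<sigma> 0) borel (gpd_map \<xi>)) {a<..}
      = emeasure (gpd \<sigma> 0) (gpd_map \<xi> -` {a<..})"
    by (subst emeasure_distr) (auto simp: gpd_def)
  \<comment> \<open>Almost every \<open>y\<close> is positive and then has a positive image, so
    \<open>a\<close> may be replaced by \<open>?b\<close>, where the inversion applies.\<close>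
  also have "\<dots> = emeasure (gpd \<sigma> 0) {?c<..}"
  proof (rule emeasure_eq_AE)
    show "AE y in gpd \<sigma> 0. y \<in> gpd_map \<xi> -` {a<..} \<longleftrightarrow> y \<in> {?c<..}"
      using AE_gpd_0_pos
    proof eventually_elim
      case (elim y)
      have "0 < gpd_map \<xi> y" using gpd_map_ge[OF assms, of y] elim by simp
      then have "a < gpd_map \<xi> y \<longleftrightarrow> ?b < gpd_map \<xi> y" by auto
      then show ?case using less_gpd_map_iff[OF assms, of ?b y] by simp
    qed
    show "gpd_map \<xi> -` {a<..} \<in> sets (gpd \<sigma> 0)"
      using measurable_sets[OF gpd_map_measurable, of "{a<..}" \<xi>] by (simp add: sets_gpd)
  qed (simp add: sets_gpd)
  also have "\<dots> = ennreal (exp (- ?c / \<sigma>))"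
    by (rule emeasure_gpd_0_greaterThan[OF c])
  also have "exp (- ?c / \<sigma>) = (1 + \<xi> * ?b / \<sigma>) powr (- 1 / \<xi>)"
    using p \<sigma> by (simp add: powr_def)
  finally show "emeasure (gpd \<sigma> \<xi>) {a<..} = emeasure (distr (gpd \<sigma> 0) borel (gpd_map \<xi>)) {a<..}"
    by (simp add: emeasure_gpd_greaterThan assms)
qed (auto simp: sets_gpd)

section \<open>Means, moments and the Wasserstein distance\<close>

lemma mean_gpd_map:
  assumes "0 < \<xi>" "\<xi> < 1"
  shows "has_bochner_integral (gpd \<sigma> 0) (gpd_map \<xi>) (\<sigma> / (1 - \<xi>))"
proof -
  interpret prob_space "gpd \<sigma> 0" by (rule prob_space_gpd_0)
  \<comment> \<open>Tilting with rate 1 / \<sigma> and s = \<xi> / \<sigma>; the condition s < 1 /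
    \<sigma> is exactly \<xi> < 1.\<close>
  have "has_bochner_integral (gpd \<sigma> 0) (\<lambda>y. exp (\<xi> / \<sigma> * y)) ((1 / \<sigma>) / (1 / \<sigma> - \<xi> / \<sigma>))"
    unfolding gpd_0 using assms \<sigma>
    by (intro has_bochner_integral_exp_exponential) (auto simp: divide_strict_right_mono)
  moreover have "(1 / \<sigma>) / (1 / \<sigma> - \<xi> / \<sigma>) = 1 / (1 - \<xi>)"
    using assms \<sigma> by (simp add: diff_divide_distrib[symmetric])
  moreover have "has_bochner_integral (gpd \<sigma> 0) (\<lambda>_. 1 :: real) 1"
    using prob_space by (simp add: has_bochner_integral_iff)
  ultimately have "has_bochner_integral (gpd \<sigma> 0) (\<lambda>y. \<sigma> / \<xi> * (exp (\<xi> / \<sigma> * y) - 1))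
      (\<sigma> / \<xi> * (1 / (1 - \<xi>) - 1))"
    by (intro has_bochner_integral_mult_right has_bochner_integral_diff) simp_all
  moreover have "\<sigma> / \<xi> * (1 / (1 - \<xi>) - 1) = \<sigma> / (1 - \<xi>)"
    using assms by (simp add: field_simps)
  ultimately show ?thesis by (simp add: gpd_map_def[abs_def])
qed

lemma wasserstein_gpd:
  assumes "0 < \<xi>" "\<xi> < 1"
  shows "wasserstein 1 (gpd \<sigma> \<xi>) (gpd \<sigma> 0) = \<sigma> * \<xi> / (1 - \<xi>)"
proof -
  have "wasserstein 1 (gpd \<sigma> \<xi>) (gpd \<sigma> 0) = \<sigma> / (1 - \<xi>) - \<sigma>"
    using mean_gpd_0 mean_gpd_map[OF assms] gpd_map_ge[OF assms(1)]
    by (simp add: gpd_eq_distr[OF assms(1)] wasserstein1_distr_eq_mean_diff prob_space_gpd_0 sets_gpd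
        has_bochner_integral_iff)
  also have "\<dots> = \<sigma> * \<xi> / (1 - \<xi>)" using assms by (simp add: field_simps)
  finally show ?thesis .
qed

lemma finite_moment_gpd:
  assumes "0 \<le> \<xi>" "\<xi> < 1"
  shows "finite_moment_prob 1 (gpd \<sigma> \<xi>)"
\<comment> \<open>At \<xi> = 0 division by zero makes \<open>gpd_map\<close> constantly 0, so the
  base law is treated through its own mean.\<close>
proof (cases "\<xi> = 0")
  case True
  have "integrable (gpd \<sigma> 0) (\<lambda>x. \<bar>x\<bar> powr 1)"
    using integrable_abs[OF integrable.intros[OF mean_gpd_0]] by (simp only: powr_one abs_ge_zero)
  with prob_space_gpd_0 sets_gpd[of 0] show ?thesis
    unfolding True finite_moment_prob_def by (intro conjI)
next
  case False
  with assms have \<xi>: "0 < \<xi>" by simp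
  interpret prob_space "gpd \<sigma> 0" by (rule prob_space_gpd_0)
  note [measurable_cong] = sets_gpd
  have "prob_space (gpd \<sigma> \<xi>)"
    unfolding gpd_eq_distr[OF \<xi>] by (rule prob_space_distr) measurable
  moreover have "integrable (gpd \<sigma> \<xi>) (\<lambda>x. \<bar>x\<bar> powr 1)"
    unfolding gpd_eq_distr[OF \<xi>] using mean_gpd_map[OF \<xi> assms(2)]
    by (subst integrable_distr_eq) (auto simp: has_bochner_integral_iff)
  ultimately show ?thesis by (simp add: finite_moment_prob_def sets_gpd)
qed

section \<open>Regularity and limits of the distance\<close>

lemma wasserstein_gpd_has_derivative:
  assumes "0 < \<xi>" "\<xi> < 1"
  shows "((\<lambda>t. wasserstein 1 (gpd \<sigma> t) (gpd \<sigma> 0)) has_real_derivative \<sigma> / (1 - \<xi>)\<^sup>2) (at \<xi>)"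
proof (rule has_field_derivative_transform_within_open[where S="{0<..<1}"])
  show "((\<lambda>t. \<sigma> * t / (1 - t)) has_real_derivative \<sigma> / (1 - \<xi>)\<^sup>2) (at \<xi>)"
    using assms by (auto intro!: derivative_eq_intros simp: field_simps power2_eq_square)
  show "\<sigma> * t / (1 - t) = wasserstein 1 (gpd \<sigma> t) (gpd \<sigma> 0)" if "t \<in> {0<..<1}" for t
    using that by (simp add: wasserstein_gpd)
  show "open {0<..<1::real}" by (rule open_greaterThanLessThan)
  show "\<xi> \<in> {0<..<1}" using assms by simp
qed

lemma wcp_sup_gpd: "wcp_sup 1 (gpd \<sigma>) (gpd \<sigma> 0) 0 1 = \<infinity>"
  unfolding wcp_sup_def
proof (rule SUP_PInfty)
  fix n :: nat
  \<comment> \<open>Solves \<sigma> * \<xi> / (1 - \<xi>) = n + 1; taking n + 1 instead of n keeps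
    \<xi> positive when n = 0.\<close>
  let ?\<xi> = "(real n + 1) / (real n + 1 + \<sigma>)"
  have \<xi>: "0 < ?\<xi>" "?\<xi> < 1" using \<sigma> by (auto simp: field_simps add_pos_nonneg)
  have "1 - ?\<xi> = \<sigma> / (real n + 1 + \<sigma>)" using \<sigma> by (simp add: field_simps)
  then have "wasserstein 1 (gpd \<sigma> ?\<xi>) (gpd \<sigma> 0) = real n + 1"
    using \<sigma> by (simp add: wasserstein_gpd[OF \<xi>])
  with \<xi> show "\<exists>\<xi>\<in>einterval 0 1. ereal (real n) \<le> ereal (wasserstein 1 (gpd \<sigma> \<xi>) (gpd \<sigma> 0))"
    by (intro bexI[of _ ?\<xi>]) (auto simp: einterval_def)
qed

lemma wcp_setting_gpd: "wcp_setting 1 (gpd \<sigma>) (gpd \<sigma> 0) 0 1"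
proof -
  let ?W = "\<lambda>t. wasserstein 1 (gpd \<sigma> t) (gpd \<sigma> 0)"
  have I: "einterval 0 1 = {0<..<1}" by (auto simp: einterval_def)
  have inj: "inj_on ?W {0<..<1}"
  proof (rule inj_onI)
    fix s t :: real
    assume "s \<in> {0<..<1}" "t \<in> {0<..<1}" "?W s = ?W t"
    \<comment> \<open>After cross-multiplication the products s * t cancel.\<close>
    then have "\<sigma> * (s * (1 - t)) = \<sigma> * (t * (1 - s))"
      by (simp add: wasserstein_gpd frac_eq_eq)
    with \<sigma> show "s = t" by (simp add: right_diff_distrib mult.commute)
  qed
  have diff: "?W differentiable_on {0<..<1}"
    by (intro differentiable_at_imp_differentiable_on)
      (auto simp: real_differentiable_def intro: wasserstein_gpd_has_derivative)
  have near0: "\<forall>\<^sub>F t in at_right 0. \<sigma> * t / (1 - t) = ?W t"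
    using eventually_at_right_real[of 0 1]
    by (auto simp: wasserstein_gpd elim!: eventually_mono)
  have near1: "\<forall>\<^sub>F t in at_left 1. \<sigma> * t / (1 - t) = ?W t"
    using eventually_at_left_real[of 0 1]
    by (auto simp: wasserstein_gpd elim!: eventually_mono)
  have "((\<lambda>t. \<sigma> * t / (1 - t)) \<longlongrightarrow> 0) (at_right 0)"
    by (auto intro!: tendsto_eq_intros)
  then have lim0: "(?W \<longlongrightarrow> 0) (at_right 0)"
    by (rule Lim_transform_eventually[OF _ near0])
  have "filterlim (\<lambda>t. \<sigma> * t / (1 - t)) at_top (at_left 1)"
    using \<sigma> by real_asymp
  then have "filterlim ?W at_top (at_left 1)"
    using filterlim_cong[OF refl refl near1] by blast
  then have "((\<lambda>t. ereal (?W t)) \<longlongrightarrow> \<infinity>) (at_left 1)"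
    using ereal_tendsto_simps2(2)[of ?W "at_left 1"] by (simp add: comp_def)
  \<comment> \<open>Writing 1 as \<open>ereal 1\<close> reduces the limit along extended reals to
    the one along the real filter.\<close>
  then have lim1: "(((\<lambda>t. ereal (?W t)) \<circ> real_of_ereal) \<longlongrightarrow> \<infinity>) (at_left 1)"
    unfolding one_ereal_def by (simp only: ereal_tendsto_simps1)
  have "((?W \<circ> real_of_ereal) \<longlongrightarrow> 0) (at_right 0)"
    using lim0 unfolding zero_ereal_def by (simp only: ereal_tendsto_simps1)
  with inj diff lim1 show ?thesis
    by (simp add: wcp_setting_def wcp_sup_gpd I finite_moment_gpd)
qed

end

text \<open>The distance is proportional to \<sigma>, so the hyperparameter
  \<open>\<eta> / \<sigma>\<close> cancels the scale both in the exponent and in the derivative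
  factor \<open>\<sigma> / (1 - \<xi>)\<^sup>2\<close>.\<close>

theorem proposition5:
  fixes \<sigma> \<eta> :: real
  assumes "\<sigma> > 0" and "\<eta> > 0"
  shows "wcp_setting 1 (gpd \<sigma>) (gpd \<sigma> 0) 0 1 \<and>
    (\<forall>\<xi>\<in>{0<..<1}. wcp_prior 1 (gpd \<sigma>) (gpd \<sigma> 0) 0 1 (\<eta> / \<sigma>) \<xi>
        = \<eta> / (1 - \<xi>)\<^sup>2 * exp (- \<eta> * (\<xi> / (1 - \<xi>))))"
proof (intro conjI ballI)
  show "wcp_setting 1 (gpd \<sigma>) (gpd \<sigma> 0) 0 1"
    by (rule wcp_setting_gpd) fact
  fix \<xi> :: real
  assume "\<xi> \<in> {0<..<1}"
  then have \<xi>: "0 < \<xi>" "\<xi> < 1" by auto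
  show "wcp_prior 1 (gpd \<sigma>) (gpd \<sigma> 0) 0 1 (\<eta> / \<sigma>) \<xi>
        = \<eta> / (1 - \<xi>)\<^sup>2 * exp (- \<eta> * (\<xi> / (1 - \<xi>)))"
    using assms \<xi>
    by (simp add: wcp_prior_def exp_neg_ereal_def wcp_sup_gpd wasserstein_gpd
        DERIV_imp_deriv[OF wasserstein_gpd_has_derivative])
qed

end
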